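(* Let $1\le p<\infty$, let $G=(V,E)$ be a connected undirected weighted graph whose vertex set $V$ is endowed with a metric $d$, and let $f:V\to\mathbb R$ be a Lipschitz map with respect to $d$. Then: 1. $E_p(f)(v_1,v_2)\le Lip(f)\,d_p(v_1,v_2)$ for all $v_1,v_2\in V$. 2. If $f$ is an eccentric $p$-summing functional, then there are a compact subset $S\subseteq V$ and a regular Borel probability measure $\mu$ on $S$ such that for all $v_1,v_2\in V$, $$E_p(f)(v_1,v_2)\le C(f)\,d_{p,\mu}(v_1,v_2),$$ that is, $$\inf\Big(\sum_{i=1}^{n-1}|f(v^i)-f(v^{i+1})|^p\Big)^{1/p}\le C(f)\,\inf\Big(\sum_{i=1}^{n-1}\int_S |d(v^i,w)-d(v^{i+1},w)|^p\,d\mu(w)\Big)^{1/p},$$ where both infima are taken over all finite paths $v_1=v^1\to v^2\to\cdots\to v^n=v_2$ in $G$, and $C(f)$ is the eccentric $p$-summing constant of $f$.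
   Context: Graphs are undirected and may be infinite, but any two vertices are connected by a finite path. A path from $v_1$ to $v_2$ is a finite sequence $v_1=v^1\to v^2\to\cdots\to v^{n-1}\to v^n=v_2$ of vertices with consecutive vertices adjacent (the trivial path $n=1$ is allowed when $v_1=v_2$, with empty sum $0$). All topological notions on $V$ (compactness, Borel sets) refer to $d$. $Lip(f)$ is the infimum of the constants $L$ with $|f(u)-f(v)|\le L\,d(u,v)$ for all $u,v\in V$. For $v_1,v_2\in V$, with all infima over paths from $v_1$ to $v_2$: $$E_p(f)(v_1,v_2)=\inf\Big(\sum_{i=1}^{n-1}|f(v^i)-f(v^{i+1})|^p\Big)^{1/p},\qquad d_p(v_1,v_2)=\inf\Big(\sum_{i=1}^{n-1}d(v^i,v^{i+1})^p\Big)^{1/p},$$ and, for $S\subseteq V$ compact and $\mu$ a regular Borel probability measure on $S$, $$d_{p,\mu}(v_1,v_2)=\inf\Big(\sum_{i=1}^{n-1}\int_S|d(v^i,w)-d(v^{i+1},w)|^p\,d\mu(w)\Big)^{1/p}.$$ A function $f:V\to\mathbb R$ is an eccentric $p$-summing functional if there are a nonempty compact set $K\subseteq V$ and a constant $C>0$ such that for every $n\in\mathbb N$ and all $x_1,\dots,x_n,y_1,\dots,y_n\in V$, $$\Big(\sum_{i=1}^n |f(x_i)-f(y_i)|^p\Big)^{1/p}\le C\,\sup_{w\in K}\Big(\sum_{i=1}^n |d(x_i,w)-d(y_i,w)|^p\Big)^{1/p}.$$ For such a fixed $K$, the eccentric $p$-summing constant $C(f)$ is the infimum of the constants $C$ for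 which this inequality holds. *)

theory Defs
  imports "HOL-Analysis.Analysis" "HOL-Probability.Probability"
begin

text \<open>
  The metric of the vertex set is the \<^const>\<open>dist\<close> of the ambient type, restricted to
  \<open>verts G\<close>.  The edge weights are part of the data of a weighted graph and are not tied to the
  metric; none of the notions below depends on them.  Loops are permitted.
\<close>

record 'a weighted_graph =
  verts :: "'a set"
  edges :: "'a set set"
  weight :: "'a set \<Rightarrow> real"

definition undirected_graph :: "'a weighted_graph \<Rightarrow> bool" where
  "undirected_graph G \<longleftrightarrow> edges G \<subseteq> {{u, v} | u v. u \<in> verts G \<and> v \<in> verts G}"

definition adjacent :: "'a weighted_graph \<Rightarrow> 'a \<Rightarrow> 'a \<Rightarrow> bool" where
  "adjacent G u v \<longleftrightarrow> {u, v} \<in> edges G"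

definition paths :: "'a weighted_graph \<Rightarrow> 'a \<Rightarrow> 'a \<Rightarrow> 'a list set" where
  "paths G u v = {xs. xs \<noteq> [] \<and> hd xs = u \<and> last xs = v \<and> set xs \<subseteq> verts G
     \<and> successively (adjacent G) xs}"

definition connected_graph :: "'a weighted_graph \<Rightarrow> bool" where
  "connected_graph G \<longleftrightarrow> (\<forall>u\<in>verts G. \<forall>v\<in>verts G. paths G u v \<noteq> {})"

text \<open>
  \<^const>\<open>lipschitz_on\<close> only admits constants \<open>L \<ge> 0\<close>; without this the set would be unbounded
  below on a one-point vertex set.
\<close>

definition Lip :: "'a::metric_space set \<Rightarrow> ('a \<Rightarrow> real) \<Rightarrow> real" where
  "Lip V f = Inf {L. L-lipschitz_on V f}"

definition E_p :: "real \<Rightarrow> 'a weighted_graph \<Rightarrow> ('a \<Rightarrow> real) \<Rightarrow> 'a \<Rightarrow> 'a \<Rightarrow> real" where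
  "E_p p G f u v = (INF xs\<in>paths G u v.
     (\<Sum>i<length xs - 1. \<bar>f (xs ! i) - f (xs ! Suc i)\<bar> powr p) powr (1 / p))"

definition d_p :: "real \<Rightarrow> 'a::metric_space weighted_graph \<Rightarrow> 'a \<Rightarrow> 'a \<Rightarrow> real" where
  "d_p p G u v = (INF xs\<in>paths G u v.
     (\<Sum>i<length xs - 1. dist (xs ! i) (xs ! Suc i) powr p) powr (1 / p))"

definition d_p_measure ::
    "real \<Rightarrow> 'a::metric_space measure \<Rightarrow> 'a weighted_graph \<Rightarrow> 'a \<Rightarrow> 'a \<Rightarrow> real" where
  "d_p_measure p \<mu> G u v = (INF xs\<in>paths G u v.
     (\<Sum>i<length xs - 1. \<integral>w. \<bar>dist (xs ! i) w - dist (xs ! Suc i) w\<bar> powr p \<partial>\<mu>) powr (1 / p))"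

definition regular_borel_prob_on :: "'a::metric_space set \<Rightarrow> 'a measure \<Rightarrow> bool" where
  "regular_borel_prob_on S \<mu> \<longleftrightarrow>
     sets \<mu> = sets (restrict_space borel S) \<and> prob_space \<mu> \<and>
     (\<forall>A\<in>sets \<mu>. emeasure \<mu> A = (SUP K\<in>{K. compact K \<and> K \<subseteq> A}. emeasure \<mu> K) \<and>
        emeasure \<mu> A = (INF U\<in>{U. openin (top_of_set S) U \<and> A \<subseteq> U}. emeasure \<mu> U))"

definition eccentric_bound ::
    "real \<Rightarrow> 'a::metric_space set \<Rightarrow> 'a set \<Rightarrow> ('a \<Rightarrow> real) \<Rightarrow> real \<Rightarrow> bool" where
  "eccentric_bound p V K f C \<longleftrightarrow>
     (\<forall>n (x :: nat \<Rightarrow> 'a) y. (\<forall>i<n. x i \<in> V \<and> y i \<in> V) \<longrightarrow>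
        (\<Sum>i<n. \<bar>f (x i) - f (y i)\<bar> powr p) powr (1 / p) \<le>
        C * (SUP w\<in>K. (\<Sum>i<n. \<bar>dist (x i) w - dist (y i) w\<bar> powr p) powr (1 / p)))"

definition eccentric_p_summing_wrt ::
    "real \<Rightarrow> 'a::metric_space set \<Rightarrow> 'a set \<Rightarrow> ('a \<Rightarrow> real) \<Rightarrow> bool" where
  "eccentric_p_summing_wrt p V K f \<longleftrightarrow>
     K \<noteq> {} \<and> compact K \<and> K \<subseteq> V \<and> (\<exists>C>0. eccentric_bound p V K f C)"

definition eccentric_p_summing :: "real \<Rightarrow> 'a::metric_space set \<Rightarrow> ('a \<Rightarrow> real) \<Rightarrow> bool" where
  "eccentric_p_summing p V f \<longleftrightarrow> (\<exists>K. eccentric_p_summing_wrt p V K f)"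

definition eccentric_const ::
    "real \<Rightarrow> 'a::metric_space set \<Rightarrow> 'a set \<Rightarrow> ('a \<Rightarrow> real) \<Rightarrow> real" where
  "eccentric_const p V K f = Inf {C. C > 0 \<and> eccentric_bound p V K f C}"

end

theory Submission
  imports Defs
begin

text \<open>
  Part 1 compares the two infima path by path. Part 2 is a Pietsch domination argument: for some
  probability measure \<open>\<mu>\<close> on \<open>K\<close>, all \<open>x, y\<close> satisfy
  \<open>\<bar>f(x) - f(y)\<bar>\<^sup>p \<le> C(f)\<^sup>p \<integral>\<bar>d(x,w) - d(y,w)\<bar>\<^sup>p d\<mu>(w)\<close>, and this is summed along paths.
  The usual appeal to Hahn-Banach and Riesz representation is replaced by elementary steps. Greedily
  chosen points \<open>w\<^sub>1, w\<^sub>2, \<dots>\<close> of \<open>K\<close> have empirical measures that satisfy finitely many of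
  these inequalities up to \<open>\<epsilon>\<close>. For a weak limit, \<open>K\<close> is presented as a continuous image of a
  compact set of reals with a (discontinuous) section; the empirical measures are moved to the real
  line by the section, Helly's theorem applies there, and the limit is pushed back to \<open>K\<close>,
  together with its regularity.
\<close>

subsection \<open>Coding a compact metric space by real numbers\<close>

text \<open>A first nonzero digit at a position \<open>k \<le> n\<close> would contribute
  \<open>(1/3) ^ k\<close> in absolute value and the later digits at most half of that, so the sum
  could not stay below \<open>(1/3) ^ n / 2\<close>. Base 3 leaves this margin for differences of
  binary digits.\<close>

lemma ternary_digits_eq_0:
  fixes d :: "nat \<Rightarrow> real"
  assumes d: "\<And>k. d k \<in> {-1, 0, 1}"
    and small: "\<bar>\<Sum>k. d k * (1/3) ^ k\<bar> < (1/3) ^ n / 2" and "k \<le> n"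
  shows "d k = 0"
  using \<open>k \<le> n\<close>
proof (induction k rule: less_induct)
  case (less k)
  have d1: "\<bar>d j\<bar> \<le> 1" for j
    using d[of j] by auto
  have geom: "summable (\<lambda>j. (1/3::real) ^ j)"
    by (simp add: summable_geometric)
  have summ: "summable (\<lambda>j. d j * (1/3) ^ j)"
    by (rule summable_comparison_test'[OF geom, of 0])
      (auto simp: abs_mult intro!: mult_left_le_one_le d1)
  have geomS: "(\<lambda>j. (1/3::real) ^ (j + Suc k)) sums ((1/3) ^ k / 2)"
  proof -
    have "(\<lambda>j. (1/3::real) ^ Suc k * (1/3) ^ j) sums ((1/3) ^ Suc k * (1 / (1 - 1/3)))"
      by (intro sums_mult geometric_sums) auto
    then show ?thesis
      by (simp add: power_add mult_ac)
  qed
  have tail: "\<bar>\<Sum>j. d (j + Suc k) * (1/3) ^ (j + Suc k)\<bar> \<le> (1/3) ^ k / 2"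
  proof -
    have "norm (\<Sum>j. d (j + Suc k) * (1/3) ^ (j + Suc k)) \<le> (\<Sum>j. (1/3) ^ (j + Suc k))"
      by (rule norm_suminf_le)
        (use sums_summable[OF geomS] in \<open>auto simp: abs_mult intro!: mult_left_le_one_le d1\<close>)
    then show ?thesis
      using sums_unique[OF geomS] by simp
  qed
  have "(\<Sum>j. d j * (1/3) ^ j) = (\<Sum>j. d (j + Suc k) * (1/3) ^ (j + Suc k)) + (\<Sum>j<Suc k. d j * (1/3) ^ j)"
    by (rule suminf_split_initial_segment[OF summ])
  also have "(\<Sum>j<Suc k. d j * (1/3) ^ j) = d k * (1/3) ^ k"
    using less by (simp add: sum.neutral)
  finally have "\<bar>d k * (1/3) ^ k\<bar> < (1/3) ^ n / 2 + (1/3) ^ k / 2"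
    using tail small by linarith
  moreover have "(1/3::real) ^ n \<le> (1/3) ^ k"
    using less.prems by (intro power_decreasing) auto
  ultimately have "\<bar>d k * (1/3) ^ k\<bar> < (1/3) ^ k"
    by linarith
  then show ?case
    using d[of k] by (auto simp: abs_mult)
qed

lemma compact_imp_dense_sequence:
  fixes K :: "'a::metric_space set"
  assumes "compact K" "K \<noteq> {}"
  obtains q :: "nat \<Rightarrow> 'a" where "range q \<subseteq> K" "K \<subseteq> closure (range q)"
proof -
  have "\<exists>A\<subseteq>K. finite A \<and> K \<subseteq> (\<Union>a\<in>A. ball a (1 / real (Suc n)))" for n
  proof -
    obtain A where "A \<subseteq> K" "finite A" "K \<subseteq> (\<Union>a\<in>A. ball a (1 / real (Suc n)))"
      by (rule compactE_image[OF \<open>compact K\<close>, of K "\<lambda>a. ball a (1 / real (Suc n))"]) auto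
    then show ?thesis by blast
  qed
  then obtain A where A: "\<And>n. A n \<subseteq> K" "\<And>n. finite (A n)"
    "\<And>n. K \<subseteq> (\<Union>a\<in>A n. ball a (1 / real (Suc n)))"
    by metis
  let ?D = "\<Union>n. A n"
  have D: "countable ?D"
    using A(2) by (auto intro: countable_finite)
  have "?D \<noteq> {}"
    using A(3)[of 0] \<open>K \<noteq> {}\<close> by auto
  with D have rng: "range (from_nat_into ?D) = ?D"
    by (rule range_from_nat_into[rotated])
  have "w \<in> closure ?D" if "w \<in> K" for w
    unfolding closure_approachable
  proof safe
    fix e :: real assume "0 < e"
    then obtain n where n: "1 / real (Suc n) < e"
      using nat_approx_posE by blast
    obtain a where "a \<in> A n" "dist a w < 1 / real (Suc n)"
      using A(3)[of n] \<open>w \<in> K\<close> by auto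
    with n show "\<exists>y\<in>?D. dist y w < e"
      by (intro bexI[of _ a]) auto
  qed
  then show thesis
    by (intro that[of "from_nat_into ?D"]) (use rng A(1) in auto)
qed

text \<open>
  The ternary digits of \<open>c w\<close> record which members of a countable family of balls contain \<open>w\<close>.
  The code \<open>c\<close> is not continuous, but its inverse is uniformly continuous, so that the inverse
  extends to the closure of the set of codes.
\<close>

lemma compact_real_code:
  fixes K :: "'a::metric_space set"
  assumes "compact K" "K \<noteq> {}"
  obtains c :: "'a \<Rightarrow> real" and Z h where "compact Z" "c ` K \<subseteq> Z" "continuous_on Z h"
    "h ` Z \<subseteq> K" "\<And>w. w \<in> K \<Longrightarrow> h (c w) = w"
proof -
  obtain q :: "nat \<Rightarrow> 'a" where q: "range q \<subseteq> K" "K \<subseteq> closure (range q)"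
    using compact_imp_dense_sequence[OF assms] .
  \<comment> \<open>Each pair of a centre \<open>q i\<close> and a radius
    \<open>1 / real (Suc b)\<close> receives the digit position
    \<open>prod_encode (i, b)\<close>.\<close>
  define U where "U k = (case prod_decode k of (i, b) \<Rightarrow> ball (q i) (1 / real (Suc b)))" for k
  define c where "c w = (\<Sum>k. indicat_real (U k) w * (1/3) ^ k)" for w
  have geom: "summable (\<lambda>j. (1/3::real) ^ j)"
    by (simp add: summable_geometric)
  have summ: "summable (\<lambda>j. indicat_real (U j) w * (1/3) ^ j)" for w
    by (rule summable_comparison_test'[OF geom, of 0]) (auto simp: indicator_def)
  have c_bound: "\<bar>c w\<bar> \<le> 2" for w
  proof -
    have "norm (c w) \<le> (\<Sum>j. (1/3) ^ j)"
      unfolding c_def by (rule norm_suminf_le[OF _ geom]) (auto simp: indicator_def)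
    also have "\<dots> \<le> 2"
      by (simp add: suminf_geometric)
    finally show ?thesis by simp
  qed
  have uc: "\<exists>\<delta>>0. \<forall>w\<in>K. \<forall>w'\<in>K. \<bar>c w - c w'\<bar> < \<delta> \<longrightarrow> dist w w' < e" if "0 < e" for e
  proof -
    obtain b where b: "1 / real (Suc b) < e / 2"
      using nat_approx_posE[of "e/2"] \<open>0 < e\<close> by auto
    have "K \<subseteq> (\<Union>i\<in>UNIV. ball (q i) (1 / real (Suc b)))"
    proof
      fix w assume "w \<in> K"
      then obtain i where "dist (q i) w < 1 / real (Suc b)"
        using q(2) unfolding closure_approachable subset_iff by force
      then show "w \<in> (\<Union>i\<in>UNIV. ball (q i) (1 / real (Suc b)))" by auto
    qed
    then obtain I where I: "finite I" "K \<subseteq> (\<Union>i\<in>I. ball (q i) (1 / real (Suc b)))"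
      by (rule compactE_image[OF \<open>compact K\<close>, rotated]) auto
    \<comment> \<open>The digits up to \<open>n\<close> decide membership in every ball of the
      finite subcover, and codes closer than \<open>(1/3) ^ n / 2\<close> agree in all of
      them.\<close>
    define n where "n = Max (insert 0 ((\<lambda>i. prod_encode (i, b)) ` I))"
    have n: "prod_encode (i, b) \<le> n" if "i \<in> I" for i
      unfolding n_def using I(1) that by (intro Max_ge) auto
    show ?thesis
    proof (intro exI[of _ "(1/3) ^ n / 2"] conjI ballI impI)
      fix w w' assume w: "w \<in> K" "w' \<in> K" and close: "\<bar>c w - c w'\<bar> < (1/3) ^ n / 2"
      obtain i where i: "i \<in> I" "w \<in> ball (q i) (1 / real (Suc b))"
        using I w by blast
      define d where "d k = indicat_real (U k) w - indicat_real (U k) w'" for k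
      have "(\<Sum>k. d k * (1/3) ^ k) = c w - c w'"
        unfolding c_def d_def by (subst suminf_diff[OF summ summ]) (simp add: algebra_simps)
      then have "d (prod_encode (i, b)) = 0"
        using close n[OF i(1)]
        by (intro ternary_digits_eq_0[of d n]) (auto simp: d_def indicator_def)
      then have "w' \<in> ball (q i) (1 / real (Suc b))"
        using i by (auto simp: d_def U_def indicator_def split: if_splits)
      with i b show "dist w w' < e"
        using dist_triangle_half_r[of "q i" w e w'] by auto
    qed simp
  qed
  define Z where "Z = closure (c ` K)"
  have "bounded (c ` K)"
    unfolding bounded_iff using c_bound by (intro exI[of _ 2]) auto
  then have "compact Z"
    unfolding Z_def by (simp add: compact_closure)
  \<comment> \<open>Compactness of \<open>K\<close> makes points whose codes tend to
    \<open>z\<close> converge along a subsequence; their limit will serve as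
    \<open>h z\<close>.\<close>
  have "\<exists>y\<in>K. \<exists>s. (\<forall>n. s n \<in> K) \<and> (\<lambda>n. c (s n)) \<longlonglongrightarrow> z \<and> s \<longlonglongrightarrow> y" if "z \<in> Z" for z
  proof -
    obtain xs where xs: "\<forall>n. xs n \<in> c ` K" "xs \<longlonglongrightarrow> z"
      using \<open>z \<in> Z\<close> unfolding Z_def closure_sequential by auto
    have "\<forall>n. \<exists>w. w \<in> K \<and> xs n = c w"
      using xs(1) by auto
    then obtain s where s: "\<And>n. s n \<in> K" "\<And>n. xs n = c (s n)"
      by metis
    obtain y r where "y \<in> K" "strict_mono r" "(s \<circ> r) \<longlonglongrightarrow> y"
      using \<open>compact K\<close> s(1) unfolding compact_def by blast
    moreover have "(\<lambda>n. c ((s \<circ> r) n)) \<longlonglongrightarrow> z"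
      using LIMSEQ_subseq_LIMSEQ[OF xs(2) \<open>strict_mono r\<close>] s(2) by (simp add: o_def)
    ultimately show ?thesis
      using s(1) by (intro bexI[of _ y] exI[of _ "s \<circ> r"]) auto
  qed
  then obtain h s where h: "\<And>z. z \<in> Z \<Longrightarrow> h z \<in> K" "\<And>z n. z \<in> Z \<Longrightarrow> s z n \<in> K"
    "\<And>z. z \<in> Z \<Longrightarrow> (\<lambda>n. c (s z n)) \<longlonglongrightarrow> z" "\<And>z. z \<in> Z \<Longrightarrow> s z \<longlonglongrightarrow> h z"
    by metis
  have cZ: "c ` K \<subseteq> Z"
    unfolding Z_def by (rule closure_subset)
  have hc: "h (c w) = w" if "w \<in> K" for w
  proof -
    have z: "c w \<in> Z" using cZ that by blast
    \<comment> \<open>The codes of the approximating points tend to \<open>c w\<close>, so by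
      \<open>uc\<close> the points themselves tend to \<open>w\<close>; this forces the value chosen
      for \<open>h (c w)\<close>.\<close>
    have "s (c w) \<longlonglongrightarrow> w"
      unfolding lim_sequentially
    proof safe
      fix e :: real assume "0 < e"
      from uc[OF this] obtain \<delta> where \<delta>: "0 < \<delta>"
        "\<And>v v'. v \<in> K \<Longrightarrow> v' \<in> K \<Longrightarrow> \<bar>c v - c v'\<bar> < \<delta> \<Longrightarrow> dist v v' < e" by blast
      obtain N where "\<And>n. n \<ge> N \<Longrightarrow> dist (c (s (c w) n)) (c w) < \<delta>"
        using h(3)[OF z] \<delta>(1) unfolding lim_sequentially by blast
      then show "\<exists>N. \<forall>n\<ge>N. dist (s (c w) n) w < e"
        using \<delta>(2)[OF h(2)[OF z] that] by (auto simp: dist_real_def)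
    qed
    then show ?thesis
      using h(4)[OF z] LIMSEQ_unique by blast
  qed
  have "continuous_on Z h"
    unfolding continuous_on_iff
  proof safe
    fix z and e :: real assume z: "z \<in> Z" and "0 < e"
    \<comment> \<open>Passing to the limit turns the strict bound into a weak one, hence
      \<open>uc\<close> at \<open>e / 2\<close>.\<close>
    then have "0 < e / 2" by simp
    from uc[OF this] obtain \<delta> where \<delta>: "0 < \<delta>"
      "\<And>v v'. v \<in> K \<Longrightarrow> v' \<in> K \<Longrightarrow> \<bar>c v - c v'\<bar> < \<delta> \<Longrightarrow> dist v v' < e / 2" by blast
    show "\<exists>d>0. \<forall>z'\<in>Z. dist z' z < d \<longrightarrow> dist (h z') (h z) < e"
    proof (intro exI[of _ \<delta>] conjI ballI impI \<delta>(1))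
      fix z' assume z': "z' \<in> Z" and "dist z' z < \<delta>"
      have "(\<lambda>n. \<bar>c (s z' n) - c (s z n)\<bar>) \<longlonglongrightarrow> \<bar>z' - z\<bar>"
        by (intro tendsto_intros h z z')
      then have "\<forall>\<^sub>F n in sequentially. \<bar>c (s z' n) - c (s z n)\<bar> < \<delta>"
        using \<open>dist z' z < \<delta>\<close> by (intro order_tendstoD) (auto simp: dist_real_def)
      then have "\<forall>\<^sub>F n in sequentially. dist (s z' n) (s z n) \<le> e / 2"
        by eventually_elim (use \<delta>(2) h(2) z z' in \<open>auto intro: less_imp_le\<close>)
      moreover have "(\<lambda>n. dist (s z' n) (s z n)) \<longlonglongrightarrow> dist (h z') (h z)"
        by (intro tendsto_intros h z z')
      ultimately have "dist (h z') (h z) \<le> e / 2"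
        using tendsto_upperbound by fastforce
      then show "dist (h z') (h z) < e"
        using \<open>0 < e\<close> by simp
    qed
  qed
  then show thesis
    using that[of Z c h] \<open>compact Z\<close> cZ h(1) hc by blast
qed

subsection \<open>Measures with nonnegative integrals\<close>

text \<open>
  The next point is chosen greedily so as to control the sum of the squared negative parts of the
  partial sums; rounding these negative parts up to natural weights costs only a bounded amount
  per step.
\<close>

lemma empirical_average_approx_nonneg:
  fixes \<phi> :: "nat \<Rightarrow> 'a \<Rightarrow> real"
  assumes bdd: "\<And>i w. i < n \<Longrightarrow> w \<in> K \<Longrightarrow> \<bar>\<phi> i w\<bar> \<le> B"
    and comb: "\<And>N :: nat \<Rightarrow> nat. \<exists>w\<in>K. 0 \<le> (\<Sum>i<n. real (N i) * \<phi> i w)"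
    and "0 < \<epsilon>"
  obtains T and v :: "nat \<Rightarrow> 'a" where "0 < T" "\<And>t. v t \<in> K"
    "\<And>i. i < n \<Longrightarrow> - \<epsilon> \<le> (\<Sum>t<T. \<phi> i (v t)) / real T"
proof -
  \<comment> \<open>For \<open>n = 0\<close> the bound is vacuous and \<open>B\<close> could be
    negative.\<close>
  define B' where "B' = max B 0"
  have B': "0 \<le> B'" "\<And>i w. i < n \<Longrightarrow> w \<in> K \<Longrightarrow> \<bar>\<phi> i w\<bar> \<le> B'"
    using bdd unfolding B'_def by (auto simp: le_max_iff_disj)
  \<comment> \<open>For each index, rounding \<open>neg (S i)\<close> up in the cross term costs at
    most \<open>2 * B'\<close>, and the square of the increment at most
    \<open>B'\<^sup>2\<close>.\<close>
  define D where "D = real n * (2 * B' + B'\<^sup>2)"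
  define neg :: "real \<Rightarrow> real" where "neg x = max (- x) 0" for x
  have "\<exists>w\<in>K. (\<Sum>i<n. (neg (S i + \<phi> i w))\<^sup>2) \<le> (\<Sum>i<n. (neg (S i))\<^sup>2) + D" for S
  proof -
    obtain w where w: "w \<in> K" "0 \<le> (\<Sum>i<n. real (nat \<lceil>neg (S i)\<rceil>) * \<phi> i w)"
      using comb[of "\<lambda>i. nat \<lceil>neg (S i)\<rceil>"] by blast
    have "(neg (S i + \<phi> i w))\<^sup>2 \<le>
        (neg (S i))\<^sup>2 - 2 * (real (nat \<lceil>neg (S i)\<rceil>) * \<phi> i w) + (2 * B' + B'\<^sup>2)" if "i < n" for i
    proof -
      let ?a = "neg (S i)" and ?b = "\<phi> i w" and ?N = "real (nat \<lceil>neg (S i)\<rceil>)"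
      have b: "\<bar>?b\<bar> \<le> B'"
        using B'(2) that w(1) by blast
      have N: "\<bar>?N - ?a\<bar> \<le> 1"
        unfolding neg_def by linarith
      have "\<bar>neg (S i + ?b)\<bar> \<le> \<bar>?a - ?b\<bar>"
        unfolding neg_def by linarith
      then have "(neg (S i + ?b))\<^sup>2 \<le> (?a - ?b)\<^sup>2"
        by (simp add: abs_le_square_iff)
      also have "\<dots> = ?a\<^sup>2 - 2 * (?N * ?b) + (2 * ((?N - ?a) * ?b) + ?b\<^sup>2)"
        by (simp add: power2_eq_square algebra_simps)
      also have "(?N - ?a) * ?b \<le> B'"
      proof -
        have "\<bar>(?N - ?a) * ?b\<bar> \<le> 1 * B'"
          unfolding abs_mult using N b by (intro mult_mono) auto
        then show ?thesis by simp
      qed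
      also have "?b\<^sup>2 \<le> B'\<^sup>2"
        using b B'(1) by (simp add: abs_le_square_iff[symmetric])
      finally show ?thesis by simp
    qed
    then have "(\<Sum>i<n. (neg (S i + \<phi> i w))\<^sup>2) \<le> (\<Sum>i<n. (neg (S i))\<^sup>2 -
        2 * (real (nat \<lceil>neg (S i)\<rceil>) * \<phi> i w) + (2 * B' + B'\<^sup>2))"
      by (intro sum_mono) auto
    also have "\<dots> = (\<Sum>i<n. (neg (S i))\<^sup>2) - 2 * (\<Sum>i<n. real (nat \<lceil>neg (S i)\<rceil>) * \<phi> i w) + D"
      by (simp add: sum.distrib sum_subtractf sum_distrib_left D_def)
    also have "\<dots> \<le> (\<Sum>i<n. (neg (S i))\<^sup>2) + D"
      using w(2) by simp
    finally show ?thesis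
      using w(1) by blast
  qed
  then obtain g where g: "\<And>S. g S \<in> K"
    "\<And>S. (\<Sum>i<n. (neg (S i + \<phi> i (g S)))\<^sup>2) \<le> (\<Sum>i<n. (neg (S i))\<^sup>2) + D"
    by metis
  define S where "S = rec_nat (\<lambda>i. 0) (\<lambda>t S i. S i + \<phi> i (g S))"
  have S_Suc: "S (Suc t) = (\<lambda>i. S t i + \<phi> i (g (S t)))" for t
    by (simp add: S_def)
  have S_eq: "S t i = (\<Sum>u<t. \<phi> i (g (S u)))" for t i
    by (induction t) (simp_all add: S_Suc, simp add: S_def)
  have pot: "(\<Sum>i<n. (neg (S t i))\<^sup>2) \<le> real t * D" for t
  proof (induction t)
    case 0
    show ?case by (simp add: S_def neg_def)
  next
    case (Suc t)
    then show ?case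
      using g(2)[of "S t"] unfolding S_Suc by (simp add: algebra_simps)
  qed
  \<comment> \<open>Beyond the time \<open>D / \<epsilon>\<^sup>2\<close> the linear potential bound
    \<open>T * D\<close> is at most the square of \<open>\<epsilon> * T\<close>, so each negative
    part is at most \<open>\<epsilon> * T\<close>.\<close>
  obtain T0 :: nat where T0: "D / \<epsilon>\<^sup>2 < real T0"
    using reals_Archimedean2 by blast
  define T where "T = Suc T0"
  have "D \<le> \<epsilon>\<^sup>2 * real T"
    using T0 \<open>0 < \<epsilon>\<close> by (simp add: T_def field_simps add_increasing)
  have "- \<epsilon> \<le> (\<Sum>t<T. \<phi> i (g (S t))) / real T" if "i < n" for i
  proof -
    have "(neg (S T i))\<^sup>2 \<le> (\<Sum>i<n. (neg (S T i))\<^sup>2)"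
      by (rule member_le_sum) (use that in auto)
    also have "\<dots> \<le> real T * D"
      by (rule pot)
    also have "\<dots> \<le> real T * (\<epsilon>\<^sup>2 * real T)"
      using \<open>D \<le> \<epsilon>\<^sup>2 * real T\<close> by (intro mult_left_mono) auto
    also have "\<dots> = (\<epsilon> * real T)\<^sup>2"
      by (simp add: power2_eq_square)
    finally have "neg (S T i) \<le> \<epsilon> * real T"
      by (rule power2_le_imp_le) (use \<open>0 < \<epsilon>\<close> in simp)
    then have "- (\<epsilon> * real T) \<le> S T i"
      unfolding neg_def by simp
    then show ?thesis
      by (simp add: S_eq T_def field_simps)
  qed
  then show thesis
    using that[of T "\<lambda>t. g (S t)"] g(1) by (simp add: T_def)
qed

text \<open>Continuous images of compact sets are compact, so inner regularity passes from the line
  to \<open>K\<close> through \<open>h\<close>; outer regularity follows by complements in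
  \<open>K\<close>. The value \<open>k0\<close> makes the map total, on a null set outside
  \<open>Z\<close>.\<close>

lemma regular_borel_prob_on_distr:
  fixes M :: "real measure" and K :: "'a::metric_space set"
  assumes M: "real_distribution M" and "compact K" and "compact Z" and AE_Z: "AE z in M. z \<in> Z"
    and h: "continuous_on Z h" "h ` Z \<subseteq> K" and "k0 \<in> K"
  defines "h' \<equiv> \<lambda>z. if z \<in> Z then h z else k0"
  shows "h' \<in> M \<rightarrow>\<^sub>M restrict_space borel K"
    and "regular_borel_prob_on K (distr M (restrict_space borel K) h')"
proof -
  interpret M: real_distribution M by fact
  let ?\<mu> = "distr M (restrict_space borel K) h'"
  have K: "K \<in> sets borel" and Z: "Z \<in> sets borel"
    using \<open>compact K\<close> \<open>compact Z\<close> by (auto intro: compact_imp_closed borel_closed)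
  have setsK: "A \<in> sets (restrict_space borel K) \<longleftrightarrow> A \<subseteq> K \<and> A \<in> sets borel" for A
    using K by (subst sets_restrict_space_iff) auto
  have h'K: "h' z \<in> K" for z
    using h(2) \<open>k0 \<in> K\<close> by (auto simp: h'_def)
  have "h' \<in> borel_measurable borel"
    unfolding h'_def by (intro borel_measurable_continuous_on_if h Z continuous_intros)
  then show meas: "h' \<in> M \<rightarrow>\<^sub>M restrict_space borel K"
    using h'K by (intro measurable_restrict_space2) (auto cong: measurable_cong_sets)
  interpret \<mu>: prob_space ?\<mu>
    by (rule M.prob_space_distr[OF meas])
  have space_\<mu>: "space ?\<mu> = K"
    by (simp add: space_restrict_space)
  have inner: "emeasure ?\<mu> A = (SUP Q\<in>{Q. compact Q \<and> Q \<subseteq> A}. emeasure ?\<mu> Q)"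
    if A: "A \<in> sets ?\<mu>" for A
  proof (rule antisym)
    have pre: "h' -` A \<in> sets borel"
      using measurable_sets[OF meas, of A] A by simp
    have "emeasure ?\<mu> A = emeasure M (h' -` A)"
      using meas A by (subst emeasure_distr) auto
    \<comment> \<open>Cutting down to \<open>Z\<close> loses no mass and leaves only compact sets on
      which \<open>h'\<close> is the continuous map \<open>h\<close>.\<close>
    also have "\<dots> = emeasure M (h' -` A \<inter> Z)"
      using AE_Z pre Z by (intro emeasure_eq_AE) auto
    also have "\<dots> = (SUP Q\<in>{Q. Q \<subseteq> h' -` A \<inter> Z \<and> compact Q}. emeasure M Q)"
      using pre Z by (intro inner_regular) (auto simp: M.emeasure_finite)
    also have "\<dots> \<le> (SUP Q\<in>{Q. compact Q \<and> Q \<subseteq> A}. emeasure ?\<mu> Q)"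
    proof (rule SUP_least)
      fix Q assume "Q \<in> {Q. Q \<subseteq> h' -` A \<inter> Z \<and> compact Q}"
      then have Q: "Q \<subseteq> h' -` A" "Q \<subseteq> Z" "compact Q" by auto
      have hQ: "compact (h ` Q)"
        using Q h(1) by (intro compact_continuous_image) (auto intro: continuous_on_subset)
      have hQA: "h ` Q \<subseteq> A"
        using Q by (force simp: h'_def)
      have hQ_sets: "h ` Q \<in> sets (restrict_space borel K)"
        using hQ Q(2) h(2) by (auto simp: setsK intro: compact_imp_closed borel_closed)
      have "emeasure M Q \<le> emeasure M (h' -` (h ` Q) \<inter> space M)"
        using Q(2) measurable_sets[OF meas hQ_sets] by (intro emeasure_mono) (auto simp: h'_def)
      also have "\<dots> = emeasure ?\<mu> (h ` Q)"
        using meas hQ_sets by (subst emeasure_distr) auto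
      finally show "emeasure M Q \<le> (SUP Q\<in>{Q. compact Q \<and> Q \<subseteq> A}. emeasure ?\<mu> Q)"
        using hQ hQA by (intro SUP_upper2[of "h ` Q"]) auto
    qed
    finally show "emeasure ?\<mu> A \<le> (SUP Q\<in>{Q. compact Q \<and> Q \<subseteq> A}. emeasure ?\<mu> Q)" .
    show "(SUP Q\<in>{Q. compact Q \<and> Q \<subseteq> A}. emeasure ?\<mu> Q) \<le> emeasure ?\<mu> A"
      using A by (intro SUP_least emeasure_mono) auto
  qed
  have outer: "emeasure ?\<mu> A = (INF U\<in>{U. openin (top_of_set K) U \<and> A \<subseteq> U}. emeasure ?\<mu> U)"
    if A: "A \<in> sets ?\<mu>" for A
  proof (rule antisym)
    have open_sets: "U \<in> sets ?\<mu>" if "openin (top_of_set K) U" for U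
      using that K by (auto simp: openin_open setsK)
    have A': "K - A \<in> sets ?\<mu>"
      using sets.compl_sets[OF A] unfolding space_\<mu> .
    show "emeasure ?\<mu> A \<le> (INF U\<in>{U. openin (top_of_set K) U \<and> A \<subseteq> U}. emeasure ?\<mu> U)"
      using open_sets by (intro INF_greatest emeasure_mono) auto
    have compl: "emeasure ?\<mu> (K - B) = 1 - emeasure ?\<mu> B" if "B \<in> sets ?\<mu>" for B
      using emeasure_compl[OF that] \<mu>.emeasure_space_1 unfolding space_\<mu> by (simp add: \<mu>.emeasure_finite)
    \<comment> \<open>Complements of compact subsets of \<open>K - A\<close> are relatively open
      supersets of \<open>A\<close>, and inner regularity of \<open>K - A\<close> makes their
      measures approach that of \<open>A\<close>.\<close>
    have "(INF U\<in>{U. openin (top_of_set K) U \<and> A \<subseteq> U}. emeasure ?\<mu> U)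
        \<le> (INF Q\<in>{Q. compact Q \<and> Q \<subseteq> K - A}. 1 - emeasure ?\<mu> Q)"
    proof (rule INF_greatest)
      fix Q assume "Q \<in> {Q. compact Q \<and> Q \<subseteq> K - A}"
      then have Q: "compact Q" "Q \<subseteq> K - A" by auto
      then have Q_sets: "Q \<in> sets ?\<mu>"
        by (auto simp: setsK intro: compact_imp_closed borel_closed)
      have "openin (top_of_set K) (K - Q)"
        using Q by (auto simp: openin_open intro!: exI[of _ "- Q"] compact_imp_closed)
      moreover have "A \<subseteq> K - Q"
        using Q A by (auto simp: setsK)
      ultimately show "(INF U\<in>{U. openin (top_of_set K) U \<and> A \<subseteq> U}. emeasure ?\<mu> U)
          \<le> 1 - emeasure ?\<mu> Q"
        using compl[OF Q_sets] by (intro INF_lower2[of "K - Q"]) auto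
    qed
    also have "\<dots> = 1 - (SUP Q\<in>{Q. compact Q \<and> Q \<subseteq> K - A}. emeasure ?\<mu> Q)"
      by (rule ennreal_SUP_const_minus) auto
    also have "\<dots> = 1 - emeasure ?\<mu> (K - A)"
      using inner[OF A'] by simp
    also have "\<dots> = emeasure ?\<mu> (K - (K - A))"
      using compl[OF A'] by simp
    also have "K - (K - A) = A"
      using A by (auto simp: setsK)
    finally show "(INF U\<in>{U. openin (top_of_set K) U \<and> A \<subseteq> U}. emeasure ?\<mu> U) \<le> emeasure ?\<mu> A" .
  qed
  show "regular_borel_prob_on K ?\<mu>"
    unfolding regular_borel_prob_on_def
  proof (intro conjI ballI)
    show "prob_space ?\<mu>" by (rule \<mu>.prob_space_axioms)
    show "sets ?\<mu> = sets (restrict_space borel K)" by simp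
  qed (fact inner outer)+
qed

text \<open>The \<open>n\<close>-th empirical measure keeps the first \<open>n\<close> integrals at
  least \<open>- 1 / (n + 1)\<close>, and a weak limit makes all of them nonnegative. The assumption
  \<open>comb\<close> is a Farkas-type condition: no natural combination of the functions is
  negative on all of \<open>K\<close>.\<close>

lemma ex_regular_measure_integral_nonneg:
  fixes K :: "'a::metric_space set" and \<phi> :: "nat \<Rightarrow> 'a \<Rightarrow> real"
  assumes "compact K" "K \<noteq> {}" and cont: "\<And>i. continuous_on K (\<phi> i)"
    and comb: "\<And>n N. \<exists>w\<in>K. 0 \<le> (\<Sum>i<n. real (N i) * \<phi> i w)"
  obtains \<mu> where "regular_borel_prob_on K \<mu>" "\<And>i. 0 \<le> (\<integral>w. \<phi> i w \<partial>\<mu>)"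
proof -
  obtain c :: "'a \<Rightarrow> real" and Z h where Z: "compact Z" "c ` K \<subseteq> Z" and h: "continuous_on Z h"
    "h ` Z \<subseteq> K" and hc: "\<And>w. w \<in> K \<Longrightarrow> h (c w) = w"
    using compact_real_code[OF assms(1,2)] by metis
  obtain k0 where k0: "k0 \<in> K"
    using \<open>K \<noteq> {}\<close> by blast
  have "\<exists>B. \<forall>w\<in>K. \<bar>\<phi> i w\<bar> \<le> B" for i
    using compact_imp_bounded[OF compact_continuous_image[OF cont \<open>compact K\<close>], of i]
    by (auto simp: bounded_iff)
  then obtain B where B: "\<And>i w. w \<in> K \<Longrightarrow> \<bar>\<phi> i w\<bar> \<le> B i"
    by metis
  have "\<exists>T v. 0 < T \<and> (\<forall>t. v t \<in> K) \<and>
      (\<forall>i<n. - (1 / real (Suc n)) \<le> (\<Sum>t<T. \<phi> i (v t)) / real T)" for n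
  proof -
    have bnd: "\<bar>\<phi> i w\<bar> \<le> (\<Sum>j<n. \<bar>B j\<bar>)" if "i < n" "w \<in> K" for i w
    proof -
      have "\<bar>\<phi> i w\<bar> \<le> \<bar>B i\<bar>"
        using B[OF that(2), of i] by linarith
      also have "\<dots> \<le> (\<Sum>j<n. \<bar>B j\<bar>)"
        using that(1) by (intro member_le_sum) auto
      finally show ?thesis .
    qed
    obtain T v where "0 < T" "\<And>t. v t \<in> K"
        "\<And>i. i < n \<Longrightarrow> - (1 / real (Suc n)) \<le> (\<Sum>t<T. \<phi> i (v t)) / real T"
      by (rule empirical_average_approx_nonneg[OF bnd comb, where \<epsilon> = "1 / real (Suc n)"]) auto
    then show ?thesis by blast
  qed
  then obtain T v where T: "\<And>n. 0 < T n" and v: "\<And>n t. v n t \<in> K"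
    and avg: "\<And>n i. i < n \<Longrightarrow> - (1 / real (Suc n)) \<le> (\<Sum>t<T n. \<phi> i (v n t)) / real (T n)"
    by metis
  \<comment> \<open>Every function on a discrete space is measurable, so the discontinuous code
    \<open>c\<close> may carry the empirical measure to the line.\<close>
  define \<nu> where "\<nu> n = distr (measure_pmf (pmf_of_set {..<T n})) borel (\<lambda>t. c (v n t))" for n
  have \<nu>: "real_distribution (\<nu> n)" for n
    unfolding \<nu>_def by (rule prob_space.real_distribution_distr[OF measure_pmf.prob_space_axioms]) simp
  have cvZ: "c (v n t) \<in> Z" for n t
    using v Z(2) by blast
  have int_\<nu>: "(\<integral>z. F z \<partial>\<nu> n) = (\<Sum>t<T n. F (c (v n t))) / real (T n)"
    if "F \<in> borel_measurable borel" for F :: "real \<Rightarrow> real" and n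
    unfolding \<nu>_def using that T[of n]
    by (subst integral_distr) (auto simp: integral_pmf_of_set lessThan_empty_iff)
  obtain R where R: "\<And>z. z \<in> Z \<Longrightarrow> \<bar>z\<bar> < R"
    using compact_imp_bounded[OF Z(1)] unfolding bounded_pos_less by auto
  have "tight \<nu>"
    unfolding tight_def
  proof (intro conjI allI impI \<nu>)
    fix e :: real assume "0 < e"
    have "\<bar>c (v 0 0)\<bar> < R"
      using R cvZ by blast
    then have "- R < R" by linarith
    moreover have "measure (\<nu> n) {- R<..R} = 1" for n
    proof -
      have "(\<lambda>t. c (v n t)) -` {- R<..R} = UNIV"
        using R[OF cvZ] by (force simp: abs_less_iff intro: less_imp_le)
      then show ?thesis
        unfolding \<nu>_def by (subst measure_distr) auto
    qed
    ultimately show "\<exists>a b. a < b \<and> (\<forall>n. 1 - e < measure (\<nu> n) {a<..b})"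
      using \<open>0 < e\<close> by (intro exI[of _ "- R"] exI[of _ R]) auto
  qed
  \<comment> \<open>All \<open>\<nu> n\<close> live on the bounded set \<open>Z\<close>, so Helly's
    theorem yields a weak limit along \<open>r\<close>.\<close>
  then obtain r M where r: "strict_mono (r :: nat \<Rightarrow> nat)" and M: "real_distribution M"
    and "weak_conv_m (\<nu> \<circ> id \<circ> r) M"
    using tight_imp_convergent_subsubsequence[of \<nu> id] strict_mono_id by blast
  then have lim: "(\<lambda>n. \<integral>z. F z \<partial>\<nu> (r n)) \<longlonglongrightarrow> (\<integral>z. F z \<partial>M)"
    if "continuous_on UNIV F" "\<And>z. \<bar>F z\<bar> \<le> b" for F :: "real \<Rightarrow> real" and b
    using weak_conv_imp_integral_bdd_continuous_conv[of "\<nu> \<circ> id \<circ> r" M F b] \<nu> that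
    by (simp add: continuous_on_eq_continuous_at)
  interpret M: real_distribution M by fact
  have "Z \<noteq> {}"
    using cvZ by blast
  have AE_Z: "AE z in M. z \<in> Z"
  proof -
    \<comment> \<open>The truncated distance to \<open>Z\<close> is a bounded continuous test
      function vanishing exactly on \<open>Z\<close>; its integrals are 0 along the sequence and
      hence in the limit.\<close>
    define F where "F z = min 1 (infdist z Z)" for z
    have F: "continuous_on UNIV F" "\<And>z. 0 \<le> F z" "\<And>z. \<bar>F z\<bar> \<le> 1"
      unfolding F_def by (auto intro!: continuous_intros simp: infdist_nonneg)
    have "(\<integral>z. F z \<partial>\<nu> n) = 0" for n
      using F(1) cvZ by (subst int_\<nu>) (auto intro: borel_measurable_continuous_onI simp: F_def)
    then have "(\<integral>z. F z \<partial>M) = 0"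
      using lim[OF F(1,3)] by (simp add: LIMSEQ_const_iff)
    moreover have "F \<in> borel_measurable M"
      using borel_measurable_continuous_onI[OF F(1)] by simp
    moreover have "integrable M F"
      by (rule M.integrable_const_bound[of _ 1]) (use F calculation in auto)
    ultimately have "AE z in M. F z = 0"
      using F(2) by (subst (asm) integral_nonneg_eq_0_iff_AE) auto
    then show ?thesis
    proof eventually_elim
      fix z assume "F z = 0"
      then have "infdist z Z = 0"
        by (auto simp: F_def min_def split: if_splits)
      then show "z \<in> Z"
        using \<open>compact Z\<close> \<open>Z \<noteq> {}\<close> by (simp add: in_closed_iff_infdist_zero compact_imp_closed)
    qed
  qed
  define h' where "h' = (\<lambda>z. if z \<in> Z then h z else k0)"
  define \<mu> where "\<mu> = distr M (restrict_space borel K) h'"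
  have meas: "h' \<in> M \<rightarrow>\<^sub>M restrict_space borel K" and reg: "regular_borel_prob_on K \<mu>"
    using regular_borel_prob_on_distr[OF M \<open>compact K\<close> Z(1) AE_Z h k0]
    unfolding h'_def \<mu>_def by auto
  have "0 \<le> (\<integral>w. \<phi> i w \<partial>\<mu>)" for i
  proof -
    have \<phi>h: "continuous_on Z (\<lambda>z. \<phi> i (h z))"
      using h by (intro continuous_on_compose2[OF cont h(1)]) auto
    have b: "\<bar>\<phi> i (h z)\<bar> \<le> max 0 (B i)" if "z \<in> Z" for z
      using B[of "h z" i] h(2) that by (auto simp: le_max_iff_disj)
    \<comment> \<open>Weak convergence is tested on the whole line, so Tietze's theorem extends
      \<open>\<phi> i \<circ> h\<close> from \<open>Z\<close> with the same bound.\<close>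
    obtain F where F: "continuous_on UNIV F" "\<And>z. z \<in> Z \<Longrightarrow> F z = \<phi> i (h z)"
      "\<And>z. \<bar>F z\<bar> \<le> max 0 (B i)"
      using Tietze[OF \<phi>h, of UNIV "max 0 (B i)"] b \<open>compact Z\<close>
      by (auto simp: compact_imp_closed)
    have F_meas: "F \<in> borel_measurable borel"
      using F(1) by (rule borel_measurable_continuous_onI)
    have "(\<integral>w. \<phi> i w \<partial>\<mu>) = (\<integral>z. \<phi> i (h' z) \<partial>M)"
      unfolding \<mu>_def
      by (rule integral_distr[OF meas borel_measurable_continuous_on_restrict[OF cont]])
    also have "\<dots> = (\<integral>z. F z \<partial>M)"
    proof (rule integral_cong_AE)
      show "(\<lambda>z. \<phi> i (h' z)) \<in> borel_measurable M"
        using measurable_compose[OF meas borel_measurable_continuous_on_restrict[OF cont]] .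
      show "F \<in> borel_measurable M"
        using F_meas by simp
      show "AE z in M. \<phi> i (h' z) = F z"
        using AE_Z by eventually_elim (simp add: F(2) h'_def)
    qed
    finally have int: "(\<integral>w. \<phi> i w \<partial>\<mu>) = (\<integral>z. F z \<partial>M)" .
    \<comment> \<open>The extension takes the value \<open>\<phi> i w\<close> at the code
      \<open>c w\<close>, so these integrals are the empirical averages, for which the lower bound
      is available once \<open>i < r n\<close>.\<close>
    have "\<forall>\<^sub>F n in sequentially. - (1 / real (Suc (r n))) \<le> (\<integral>z. F z \<partial>\<nu> (r n))"
    proof (rule eventually_sequentiallyI[of "Suc i"])
      fix n assume "Suc i \<le> n"
      then have "i < r n"
        using strict_mono_imp_increasing[OF r, of n] by simp
      then show "- (1 / real (Suc (r n))) \<le> (\<integral>z. F z \<partial>\<nu> (r n))"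
        using avg[of i "r n"] by (simp add: int_\<nu>[OF F_meas] F(2)[OF cvZ] hc[OF v])
    qed
    moreover have "(\<lambda>n. - (1 / real (Suc (r n)))) \<longlonglongrightarrow> - 0"
      using LIMSEQ_subseq_LIMSEQ[OF lim_inverse_n'[THEN LIMSEQ_Suc] r]
      by (intro tendsto_minus) (simp add: o_def)
    ultimately show ?thesis
      using tendsto_le[OF _ lim[OF F(1,3)]] int by fastforce
  qed
  with reg show thesis
    by (rule that)
qed

subsection \<open>Eccentric domination\<close>

text \<open>One element is picked for every basic open set that meets the image of \<open>A\<close>.
  Density is measured in the second countable target of \<open>e\<close>, which allows a countable
  \<open>D\<close> for an arbitrary set \<open>A\<close>.\<close>

lemma countable_dense_subset_wrt:
  fixes e :: "'b \<Rightarrow> 'c::{second_countable_topology, metric_space}"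
  obtains D where "countable D" "D \<subseteq> A"
    "\<And>a. a \<in> A \<Longrightarrow> \<exists>s. (\<forall>n. s n \<in> D) \<and> (\<lambda>n. e (s n)) \<longlonglongrightarrow> e a"
proof -
  obtain \<B> :: "'c set set" where \<B>: "countable \<B>" "topological_basis \<B>"
    using ex_countable_basis by blast
  define pick where "pick b = (SOME a. a \<in> A \<and> e a \<in> b)" for b
  define D where "D = pick ` {b \<in> \<B>. \<exists>a\<in>A. e a \<in> b}"
  have pick: "pick b \<in> A \<and> e (pick b) \<in> b" if "\<exists>a\<in>A. e a \<in> b" for b
    unfolding pick_def by (rule someI_ex) (use that in blast)
  have "\<exists>s. (\<forall>n. s n \<in> D) \<and> (\<lambda>n. e (s n)) \<longlonglongrightarrow> e a" if "a \<in> A" for a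
  proof -
    have "e a \<in> closure (e ` D)"
      unfolding closure_iff_nhds_not_empty
    proof safe
      fix U W assume "open U" "U \<subseteq> W" "e a \<in> U" and empty: "e ` D \<inter> W = {}"
      then obtain b where b: "b \<in> \<B>" "e a \<in> b" "b \<subseteq> U"
        using topological_basisE[OF \<B>(2)] by metis
      then have "pick b \<in> D" "e (pick b) \<in> b"
        using pick[of b] \<open>a \<in> A\<close> by (auto simp: D_def)
      then show False
        using b \<open>U \<subseteq> W\<close> empty by blast
    qed
    then obtain xs where xs: "\<forall>n. xs n \<in> e ` D" "xs \<longlonglongrightarrow> e a"
      unfolding closure_sequential by auto
    have "\<forall>n. \<exists>d. d \<in> D \<and> xs n = e d"
      using xs(1) by auto
    then obtain s where s: "\<And>n. s n \<in> D" "\<And>n. xs n = e (s n)"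
      by metis
    have "(\<lambda>n. e (s n)) \<longlonglongrightarrow> e a"
      using xs(2) unfolding s(2) .
    with s(1) show ?thesis
      by blast
  qed
  moreover have "countable D" "D \<subseteq> A"
    using \<B>(1) pick by (auto simp: D_def)
  ultimately show thesis
    using that by blast
qed

text \<open>Replacing \<open>w\<close> by a nearby \<open>q k\<close> changes every distance to it
  by at most \<open>dist (q k) w\<close>, uniformly in the other point, so a three-epsilon argument
  applies.\<close>

lemma dist_tendsto_of_dense:
  assumes dense: "w \<in> closure (range q)"
    and lim: "\<And>k. (\<lambda>n. dist (x n) (q k)) \<longlonglongrightarrow> dist y (q k)"
  shows "(\<lambda>n. dist (x n) w) \<longlonglongrightarrow> dist y w"
proof (rule tendstoI)
  fix \<epsilon> :: real assume "0 < \<epsilon>"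
  then obtain k where k: "dist (q k) w < \<epsilon> / 3"
    using dense unfolding closure_approachable by (metis divide_pos_pos image_iff zero_less_numeral)
  have "\<forall>\<^sub>F n in sequentially. dist (dist (x n) (q k)) (dist y (q k)) < \<epsilon> / 3"
    using \<open>0 < \<epsilon>\<close> by (intro tendstoD[OF lim]) simp
  then show "\<forall>\<^sub>F n in sequentially. dist (dist (x n) w) (dist y w) < \<epsilon>"
  proof eventually_elim
    fix n assume "dist (dist (x n) (q k)) (dist y (q k)) < \<epsilon> / 3"
    moreover have "\<bar>dist z w - dist z (q k)\<bar> \<le> dist (q k) w" for z
      using dist_triangle[of z w "q k"] dist_triangle[of z "q k" w] by (simp add: dist_commute)
    note this[of "x n"] this[of y]
    ultimately show "dist (dist (x n) w) (dist y w) < \<epsilon>"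
      using k unfolding dist_real_def by linarith
  qed
qed

lemma powr_inverse_powr:
  fixes a p :: real
  assumes "0 \<le> a" "0 < p"
  shows "(a powr (1 / p)) powr p = a" "(a powr p) powr (1 / p) = a"
  using assms by (auto simp: powr_powr)

lemma abs_diff_dist_le: "\<bar>dist x w - dist y w\<bar> \<le> dist x y"
  using dist_triangle[of x w y] dist_triangle[of y w x] by (simp add: dist_commute)

lemma continuous_on_dist_diff_powr:
  assumes "0 < (p::real)"
  shows "continuous_on S (\<lambda>w. \<bar>dist x w - dist y w\<bar> powr p)"
  using assms by (intro continuous_on_powr' continuous_intros) auto

text \<open>For each family the inequality is linear in \<open>C\<close>, with a finite nonnegative
  supremum as coefficient, so it survives the passage to the infimum of the admissible
  constants.\<close>

lemma eccentric_bound_eccentric_const: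
  assumes p: "1 \<le> p" and ecc: "eccentric_p_summing_wrt p V K f"
  shows "eccentric_bound p V K f (eccentric_const p V K f)" and "0 \<le> eccentric_const p V K f"
proof -
  let ?\<C> = "{C. C > 0 \<and> eccentric_bound p V K f C}"
  have ne: "?\<C> \<noteq> {}" and "K \<noteq> {}"
    using ecc by (auto simp: eccentric_p_summing_wrt_def)
  show "0 \<le> eccentric_const p V K f"
    unfolding eccentric_const_def using ne by (intro cInf_greatest) auto
  show "eccentric_bound p V K f (eccentric_const p V K f)"
    unfolding eccentric_bound_def
  proof (intro allI impI)
    fix n and x y :: "nat \<Rightarrow> 'a" assume V: "\<forall>i<n. x i \<in> V \<and> y i \<in> V"
    let ?l = "(\<Sum>i<n. \<bar>f (x i) - f (y i)\<bar> powr p) powr (1 / p)"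
    let ?g = "\<lambda>w. (\<Sum>i<n. \<bar>dist (x i) w - dist (y i) w\<bar> powr p) powr (1 / p)"
    let ?s = "SUP w\<in>K. ?g w"
    have le: "?l \<le> C * ?s" if "C \<in> ?\<C>" for C
      using that V unfolding eccentric_bound_def by blast
    \<comment> \<open>A bound independent of \<open>w\<close> excludes the unspecified value of an
      unbounded real supremum.\<close>
    have "?g w \<le> (\<Sum>i<n. dist (x i) (y i) powr p) powr (1 / p)" for w
      using p by (intro powr_mono2 sum_mono abs_diff_dist_le sum_nonneg) auto
    then have "bdd_above (?g ` K)"
      by (intro bdd_aboveI2)
    then have "0 \<le> ?s"
      using \<open>K \<noteq> {}\<close> by (metis (no_types, lifting) cSUP_upper2 ex_in_conv powr_ge_zero)
    \<comment> \<open>A positive supremum can be divided out; if it is 0, any admissible constant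
      already forces the left side to vanish.\<close>
    show "?l \<le> eccentric_const p V K f * ?s"
    proof (cases "?s = 0")
      case True
      then show ?thesis
        using ne le by fastforce
    next
      case False
      with \<open>0 \<le> ?s\<close> have "0 < ?s" by simp
      have "?l / ?s \<le> eccentric_const p V K f"
        unfolding eccentric_const_def
        by (rule cInf_greatest[OF ne]) (use le \<open>0 < ?s\<close> in \<open>simp add: pos_divide_le_eq\<close>)
      then show ?thesis
        using \<open>0 < ?s\<close> by (simp add: pos_divide_le_eq)
    qed
  qed
qed

text \<open>Natural multiplicities become repetitions in one list, because the eccentric bound
  speaks of families without weights.\<close>

lemma sum_nth_concat_replicate:
  fixes g :: "nat \<Rightarrow> real" and N :: "nat \<Rightarrow> nat" and n :: nat
  defines "l \<equiv> concat (map (\<lambda>i. replicate (N i) i) [0..<n])"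
  shows "(\<Sum>j<length l. g (l ! j)) = (\<Sum>i<n. real (N i) * g i)"
proof -
  have "(\<Sum>j<length l. g (l ! j)) = sum_list (map g l)"
    by (simp add: sum_list_sum_nth atLeast0LessThan)
  also have "\<dots> = (\<Sum>i<n. real (N i) * g i)"
    unfolding l_def
    by (induction n) (auto simp: sum_list_replicate)
  finally show ?thesis .
qed

text \<open>With the \<open>i\<close>-th pair repeated \<open>N i\<close> times, the eccentric bound
  compares the weighted sums. By compactness the supremum is attained at a single \<open>w\<close>,
  and taking \<open>p\<close>-th powers there gives the claim.\<close>

lemma eccentric_bound_weighted:
  fixes x y :: "nat \<Rightarrow> 'a::metric_space" and N :: "nat \<Rightarrow> nat"
  assumes p: "1 \<le> p" and K: "compact K" "K \<noteq> {}" and "0 \<le> C" and bound: "eccentric_bound p V K f C"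
    and V: "\<And>i. x i \<in> V" "\<And>i. y i \<in> V"
  shows "\<exists>w\<in>K. 0 \<le> (\<Sum>i<n. real (N i) *
    (C powr p * \<bar>dist (x i) w - dist (y i) w\<bar> powr p - \<bar>f (x i) - f (y i)\<bar> powr p))"
proof -
  define l where "l = concat (map (\<lambda>i. replicate (N i) i) [0..<n])"
  have sum_l: "(\<Sum>j<length l. g (l ! j)) = (\<Sum>i<n. real (N i) * g i)" for g :: "nat \<Rightarrow> real"
    unfolding l_def by (rule sum_nth_concat_replicate)
  define F where "F = (\<Sum>i<n. real (N i) * \<bar>f (x i) - f (y i)\<bar> powr p)"
  define g where "g w = (\<Sum>i<n. real (N i) * \<bar>dist (x i) w - dist (y i) w\<bar> powr p)" for w
  have nonneg: "0 \<le> F" "0 \<le> g w" for w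
    unfolding F_def g_def by (auto intro!: sum_nonneg)
  have "continuous_on K g"
    unfolding g_def using p by (intro continuous_intros continuous_on_dist_diff_powr) auto
  then obtain w where w: "w \<in> K" "\<And>v. v \<in> K \<Longrightarrow> g v \<le> g w"
    using continuous_attains_sup[OF K] by blast
  have "F powr (1 / p) \<le> C * (SUP v\<in>K. g v powr (1 / p))"
    using bound[unfolded eccentric_bound_def, rule_format, of "length l" "\<lambda>j. x (l ! j)" "\<lambda>j. y (l ! j)"] V
    by (simp add: F_def g_def sum_l[of "\<lambda>i. \<bar>f (x i) - f (y i)\<bar> powr p"]
        sum_l[of "\<lambda>i. \<bar>dist (x i) v - dist (y i) v\<bar> powr p" for v])
  also have "\<dots> \<le> C * (g w powr (1 / p))"
    using K w p nonneg \<open>0 \<le> C\<close> by (intro mult_left_mono cSUP_least powr_mono2) auto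
  finally have "(F powr (1 / p)) powr p \<le> (C * (g w powr (1 / p))) powr p"
    using p by (intro powr_mono2) auto
  also have "\<dots> = C powr p * g w"
    using p nonneg \<open>0 \<le> C\<close> by (simp add: powr_mult powr_inverse_powr)
  finally have "F \<le> C powr p * g w"
    using p nonneg by (simp add: powr_inverse_powr)
  then have "0 \<le> (\<Sum>i<n. real (N i) *
      (C powr p * \<bar>dist (x i) w - dist (y i) w\<bar> powr p - \<bar>f (x i) - f (y i)\<bar> powr p))"
    by (simp add: F_def g_def sum_distrib_left sum_subtractf algebra_simps)
  with w(1) show ?thesis by blast
qed

text \<open>
  It suffices to dominate countably many pairs: \<open>\<integral>\<bar>d(x,w) - d(y,w)\<bar>\<^sup>p d\<mu>\<close> depends sequentially
  continuously on the distances from \<open>x\<close> and \<open>y\<close> to a dense sequence in \<open>K\<close>, because all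
  the functions \<open>d(x,\<cdot>)\<close> are 1-Lipschitz.
\<close>

lemma eccentric_domination:
  fixes f :: "'a::metric_space \<Rightarrow> real"
  assumes p: "1 \<le> p" and ecc: "eccentric_p_summing_wrt p V K f"
  obtains \<mu> where "regular_borel_prob_on K \<mu>"
    "\<And>x y. x \<in> V \<Longrightarrow> y \<in> V \<Longrightarrow> \<bar>f x - f y\<bar> powr p \<le>
       eccentric_const p V K f powr p * (\<integral>w. \<bar>dist x w - dist y w\<bar> powr p \<partial>\<mu>)"
proof -
  define C where "C = eccentric_const p V K f"
  have C: "0 \<le> C" "eccentric_bound p V K f C"
    unfolding C_def using eccentric_bound_eccentric_const[OF p ecc] by auto
  have K: "compact K" "K \<noteq> {}" "K \<subseteq> V"
    using ecc by (auto simp: eccentric_p_summing_wrt_def)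
  obtain q :: "nat \<Rightarrow> 'a" where q: "range q \<subseteq> K" "K \<subseteq> closure (range q)"
    using compact_imp_dense_sequence[OF K(1,2)] .
  \<comment> \<open>Distances to a dense sequence determine the integrand on \<open>K\<close>;
    adjoining the values of \<open>f\<close> makes these converge as well. The target is a countable
    product of real lines, hence second countable.\<close>
  define e where "e = (\<lambda>(x, y). ((\<lambda>k. dist x (q k), \<lambda>k. dist y (q k)), (f x, f y)))"
  obtain D where D: "countable D" "D \<subseteq> V \<times> V"
    "\<And>a. a \<in> V \<times> V \<Longrightarrow> \<exists>s. (\<forall>n. s n \<in> D) \<and> (\<lambda>n. e (s n)) \<longlonglongrightarrow> e a"
    by (rule countable_dense_subset_wrt[of "V \<times> V" e]) blast
  have "D \<noteq> {}"
    using D(3) K by fast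
  define z where "z = from_nat_into D"
  have z: "range z = D"
    unfolding z_def using \<open>D \<noteq> {}\<close> D(1) by (rule range_from_nat_into)
  define G where "G x y w = \<bar>dist x w - dist y w\<bar> powr p" for x y w :: 'a
  have G_cont: "continuous_on S (G x y)" for S x y
    unfolding G_def using p by (intro continuous_on_dist_diff_powr) auto
  have zV: "fst (z i) \<in> V" "snd (z i) \<in> V" for i
    using z D(2) by (metis mem_Times_iff rangeI subsetD)+
  \<comment> \<open>The desired inequality is moved under the integral: the constant
    \<open>f\<close>-term integrates to itself against a probability measure.\<close>
  obtain \<mu> where \<mu>: "regular_borel_prob_on K \<mu>" and int_nonneg:
    "\<And>i. 0 \<le> (\<integral>w. C powr p * G (fst (z i)) (snd (z i)) w - \<bar>f (fst (z i)) - f (snd (z i))\<bar> powr p \<partial>\<mu>)"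
  proof (rule ex_regular_measure_integral_nonneg[OF K(1,2)])
    show "continuous_on K (\<lambda>w. C powr p * G (fst (z i)) (snd (z i)) w - \<bar>f (fst (z i)) - f (snd (z i))\<bar> powr p)" for i
      by (intro continuous_intros G_cont)
    show "\<exists>w\<in>K. 0 \<le> (\<Sum>i<n. real (N i) *
        (C powr p * G (fst (z i)) (snd (z i)) w - \<bar>f (fst (z i)) - f (snd (z i))\<bar> powr p))" for n N
      unfolding G_def by (intro eccentric_bound_weighted[where V = V] p K C zV)
  qed (rule that)
  have sets_\<mu>: "sets \<mu> = sets (restrict_space borel K)" and "prob_space \<mu>"
    using \<mu> by (auto simp: regular_borel_prob_on_def)
  interpret prob_space \<mu> by fact
  have space_\<mu>: "space \<mu> = K"
    using sets_eq_imp_space_eq[OF sets_\<mu>] by (simp add: space_restrict_space)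
  have G_meas: "G x y \<in> borel_measurable \<mu>" for x y
    using borel_measurable_continuous_on_restrict[OF G_cont] measurable_cong_sets[OF sets_\<mu> refl] by blast
  have G_le: "norm (G x y w) \<le> dist x y powr p" for x y w
    unfolding G_def real_norm_def
    using p abs_diff_dist_le[of x w y] by (simp add: powr_mono2)
  have G_int: "integrable \<mu> (G x y)" for x y
    by (rule integrable_const_bound[OF AE_I2[OF G_le] G_meas])
  have dom_D: "\<bar>f x - f y\<bar> powr p \<le> C powr p * (\<integral>w. G x y w \<partial>\<mu>)" if xy: "(x, y) \<in> D" for x y
  proof -
    obtain i where "z i = (x, y)"
      using xy unfolding z[symmetric] by auto
    then show ?thesis
      using int_nonneg[of i] G_int by (simp add: prob_space)
  qed
  have "\<bar>f x - f y\<bar> powr p \<le> C powr p * (\<integral>w. G x y w \<partial>\<mu>)" if xy: "x \<in> V" "y \<in> V" for x y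
  proof -
    obtain s where s: "\<And>n. s n \<in> D" and e_lim: "(\<lambda>n. e (s n)) \<longlonglongrightarrow> e (x, y)"
      using D(3)[of "(x, y)"] xy by blast
    define u v where "u n = fst (s n)" and "v n = snd (s n)" for n
    have e_s: "e (s n) = ((\<lambda>k. dist (u n) (q k), \<lambda>k. dist (v n) (q k)), (f (u n), f (v n)))" for n
      by (simp add: e_def u_def v_def split_beta)
    note e_lim = e_lim[unfolded e_s, unfolded e_def, simplified]
    have fu: "(\<lambda>n. f (u n)) \<longlonglongrightarrow> f x" and fv: "(\<lambda>n. f (v n)) \<longlonglongrightarrow> f y"
      using tendsto_fst[OF tendsto_snd[OF e_lim]] tendsto_snd[OF tendsto_snd[OF e_lim]] by simp_all
    have proj: "(\<lambda>n. g n k) \<longlonglongrightarrow> l k" if "g \<longlonglongrightarrow> l" for g :: "nat \<Rightarrow> nat \<Rightarrow> real" and l k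
      by (rule continuous_on_tendsto_compose[of UNIV "\<lambda>h. h k", OF _ that])
        (auto intro: continuous_on_product_then_coordinatewise[OF continuous_on_id])
    have du: "(\<lambda>n. dist (u n) (q k)) \<longlonglongrightarrow> dist x (q k)"
      and dv: "(\<lambda>n. dist (v n) (q k)) \<longlonglongrightarrow> dist y (q k)" for k
      using proj[OF tendsto_fst[OF tendsto_fst[OF e_lim]], of k]
        proj[OF tendsto_snd[OF tendsto_fst[OF e_lim]], of k] by simp_all
    \<comment> \<open>By the triangle inequality through \<open>q 0\<close>, a bound for these
      convergent sequences also bounds \<open>dist (u n) (v n)\<close>, and thus dominates all
      integrands.\<close>
    obtain M where M: "\<And>n. dist (u n) (q 0) + dist (v n) (q 0) \<le> M"
    proof -
      have "Bseq (\<lambda>n. dist (u n) (q 0) + dist (v n) (q 0))"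
        by (rule convergent_imp_Bseq[OF convergentI[OF tendsto_add[OF du dv]]])
      then obtain M where "0 < M" "\<forall>n. norm (dist (u n) (q 0) + dist (v n) (q 0)) \<le> M"
        by (rule BseqE)
      then show thesis
        by (intro that[of M]) (simp add: abs_le_iff)
    qed
    have "(\<lambda>n. \<integral>w. G (u n) (v n) w \<partial>\<mu>) \<longlonglongrightarrow> (\<integral>w. G x y w \<partial>\<mu>)"
    proof (rule integral_dominated_convergence[where w = "\<lambda>_. M powr p"])
      show "AE w in \<mu>. (\<lambda>n. G (u n) (v n) w) \<longlonglongrightarrow> G x y w"
      proof (rule AE_I2)
        fix w assume "w \<in> space \<mu>"
        then have w: "w \<in> closure (range q)"
          using q(2) by (auto simp: space_\<mu>)
        show "(\<lambda>n. G (u n) (v n) w) \<longlonglongrightarrow> G x y w"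
          unfolding G_def using p
          by (intro tendsto_powr' tendsto_intros dist_tendsto_of_dense[OF w] du dv) auto
      qed
      show "AE w in \<mu>. norm (G (u n) (v n) w) \<le> M powr p" for n
      proof (rule AE_I2)
        fix w
        have "\<bar>dist (u n) w - dist (v n) w\<bar> \<le> M"
          using abs_diff_dist_le[of "u n" w "v n"] dist_triangle2[of "u n" "v n" "q 0"] M[of n]
          by linarith
        then show "norm (G (u n) (v n) w) \<le> M powr p"
          unfolding G_def using p by (auto intro!: powr_mono2)
      qed
    qed (use G_meas in auto)
    then have "(\<lambda>n. C powr p * (\<integral>w. G (u n) (v n) w \<partial>\<mu>)) \<longlonglongrightarrow> C powr p * (\<integral>w. G x y w \<partial>\<mu>)"
      by (intro tendsto_intros)
    moreover have "(\<lambda>n. \<bar>f (u n) - f (v n)\<bar> powr p) \<longlonglongrightarrow> \<bar>f x - f y\<bar> powr p"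
      using p by (intro tendsto_powr' tendsto_intros fu fv) auto
    moreover have "\<bar>f (u n) - f (v n)\<bar> powr p \<le> C powr p * (\<integral>w. G (u n) (v n) w \<partial>\<mu>)" for n
      using dom_D[of "u n" "v n"] s[of n] by (simp add: u_def v_def)
    ultimately show ?thesis
      by (intro LIMSEQ_le) auto
  qed
  with \<mu> show thesis
    by (intro that) (auto simp: G_def C_def)
qed

section \<open>Passage to infima over paths\<close>

lemma cINF_le_mult_cINF:
  fixes a b :: "'b \<Rightarrow> real"
  assumes "X \<noteq> {}" "0 \<le> L" and le: "\<And>x. x \<in> X \<Longrightarrow> a x \<le> L * b x" and nonneg: "\<And>x. x \<in> X \<Longrightarrow> 0 \<le> a x"
  shows "(INF x\<in>X. a x) \<le> L * (INF x\<in>X. b x)"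
proof -
  have lower: "(INF x\<in>X. a x) \<le> L * b x" if "x \<in> X" for x
    using cINF_lower[of a X x] le[OF that] nonneg that by (force intro!: bdd_belowI2)
  show ?thesis
  proof (cases "L = 0")
    \<comment> \<open>Division by \<open>L\<close> is impossible here, but \<open>lower\<close> at
      any element bounds the infimum by 0.\<close>
    case True
    then show ?thesis
      using lower \<open>X \<noteq> {}\<close> by auto
  next
    case False
    with \<open>0 \<le> L\<close> have "0 < L" by simp
    have "(INF x\<in>X. a x) / L \<le> (INF x\<in>X. b x)"
      using lower \<open>X \<noteq> {}\<close> \<open>0 < L\<close> by (intro cINF_greatest) (auto simp: pos_divide_le_eq mult.commute)
    then show ?thesis
      using \<open>0 < L\<close> by (simp add: pos_divide_le_eq mult.commute)
  qed
qed

text \<open>Both sides are compared along the same path, so a bound for pairs of vertices is enough.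
  For the two inequalities of the theorem, \<open>g\<close> is the \<open>p\<close>-th power of the
  distance and the integral against \<open>\<mu>\<close>, respectively.\<close>

lemma E_p_le_mult:
  assumes "0 < p" "connected_graph G" "u \<in> verts G" "v \<in> verts G" "0 \<le> L"
    and g: "\<And>x y. x \<in> verts G \<Longrightarrow> y \<in> verts G \<Longrightarrow> \<bar>f x - f y\<bar> powr p \<le> L powr p * g x y"
    and g_nonneg: "\<And>x y. 0 \<le> g x y"
  shows "E_p p G f u v \<le>
    L * (INF xs\<in>paths G u v. (\<Sum>i<length xs - 1. g (xs ! i) (xs ! Suc i)) powr (1 / p))"
  unfolding E_p_def
proof (rule cINF_le_mult_cINF)
  show "paths G u v \<noteq> {}"
    using assms by (auto simp: connected_graph_def)
  fix xs assume "xs \<in> paths G u v"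
  then have V: "xs ! i \<in> verts G" if "i < length xs" for i
    using that unfolding paths_def by (auto dest: nth_mem)
  have "(\<Sum>i<length xs - 1. \<bar>f (xs ! i) - f (xs ! Suc i)\<bar> powr p) powr (1 / p)
      \<le> (\<Sum>i<length xs - 1. L powr p * g (xs ! i) (xs ! Suc i)) powr (1 / p)"
    using \<open>0 < p\<close> by (intro powr_mono2 sum_mono sum_nonneg g V) auto
  also have "\<dots> = (L powr p * (\<Sum>i<length xs - 1. g (xs ! i) (xs ! Suc i))) powr (1 / p)"
    by (simp add: sum_distrib_left)
  also have "\<dots> = L * (\<Sum>i<length xs - 1. g (xs ! i) (xs ! Suc i)) powr (1 / p)"
    using assms by (simp add: powr_mult sum_nonneg powr_inverse_powr)
  finally show "(\<Sum>i<length xs - 1. \<bar>f (xs ! i) - f (xs ! Suc i)\<bar> powr p) powr (1 / p)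
      \<le> L * (\<Sum>i<length xs - 1. g (xs ! i) (xs ! Suc i)) powr (1 / p)" .
qed (use assms in auto)

text \<open>Each quotient \<open>dist (f x) (f y) / dist x y\<close> with
  \<open>x \<noteq> y\<close> is a lower bound of the Lipschitz constants, hence at most their
  infimum.\<close>

lemma lipschitz_on_Lip:
  assumes "L-lipschitz_on V f"
  shows "(Lip V f)-lipschitz_on V f"
proof -
  let ?\<L> = "{L. L-lipschitz_on V f}"
  have ne: "?\<L> \<noteq> {}"
    using assms by blast
  show ?thesis
  proof (rule lipschitz_onI)
    show "0 \<le> Lip V f"
      unfolding Lip_def using ne by (intro cInf_greatest) (auto dest: lipschitz_on_nonneg)
    fix x y assume xy: "x \<in> V" "y \<in> V"
    show "dist (f x) (f y) \<le> Lip V f * dist x y"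
    proof (cases "x = y")
      case False
      have "dist (f x) (f y) / dist x y \<le> Lip V f"
        unfolding Lip_def using xy False
        by (intro cInf_greatest[OF ne]) (auto simp: pos_divide_le_eq dest: lipschitz_onD)
      then show ?thesis
        using False by (simp add: pos_divide_le_eq)
    qed simp
  qed
qed

theorem theorem4p11:
  fixes p :: real
    and G :: "'a::metric_space weighted_graph"
    and f :: "'a \<Rightarrow> real"
  assumes "1 \<le> p"
    and "undirected_graph G"
    and "connected_graph G"
    and "\<exists>L. L-lipschitz_on (verts G) f"
  shows "(\<forall>v1\<in>verts G. \<forall>v2\<in>verts G. E_p p G f v1 v2 \<le> Lip (verts G) f * d_p p G v1 v2) \<and>
    (eccentric_p_summing p (verts G) f \<longrightarrow>
      (\<forall>K. eccentric_p_summing_wrt p (verts G) K f \<longrightarrow>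
        (\<exists>S \<mu>. compact S \<and> S \<subseteq> verts G \<and> regular_borel_prob_on S \<mu> \<and>
          (\<forall>v1\<in>verts G. \<forall>v2\<in>verts G.
             E_p p G f v1 v2 \<le> eccentric_const p (verts G) K f * d_p_measure p \<mu> G v1 v2))))"
proof (intro conjI impI allI ballI)
  have p: "0 < p"
    using \<open>1 \<le> p\<close> by simp
  have lip: "(Lip (verts G) f)-lipschitz_on (verts G) f"
    using assms(4) lipschitz_on_Lip by blast
  fix v1 v2 assume v: "v1 \<in> verts G" "v2 \<in> verts G"
  show "E_p p G f v1 v2 \<le> Lip (verts G) f * d_p p G v1 v2"
    unfolding d_p_def
  proof (rule E_p_le_mult[OF p assms(3) v])
    show "0 \<le> Lip (verts G) f"
      using lip by (rule lipschitz_on_nonneg)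
    fix x y assume "x \<in> verts G" "y \<in> verts G"
    then have "\<bar>f x - f y\<bar> powr p \<le> (Lip (verts G) f * dist x y) powr p"
      using lipschitz_onD[OF lip] p by (intro powr_mono2) (auto simp: dist_real_def)
    then show "\<bar>f x - f y\<bar> powr p \<le> Lip (verts G) f powr p * dist x y powr p"
      using lipschitz_on_nonneg[OF lip] by (simp add: powr_mult)
  qed simp
next
  have p: "0 < p"
    using \<open>1 \<le> p\<close> by simp
  fix K assume ecc: "eccentric_p_summing_wrt p (verts G) K f"
  \<comment> \<open>The given \<open>K\<close> itself serves as \<open>S\<close>, which matches the
    constant, since that is taken with respect to \<open>K\<close>.\<close>
  obtain \<mu> where "regular_borel_prob_on K \<mu>" and dom:
    "\<And>x y. x \<in> verts G \<Longrightarrow> y \<in> verts G \<Longrightarrow> \<bar>f x - f y\<bar> powr p \<le>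
       eccentric_const p (verts G) K f powr p * (\<integral>w. \<bar>dist x w - dist y w\<bar> powr p \<partial>\<mu>)"
    using eccentric_domination[OF \<open>1 \<le> p\<close> ecc] by blast
  moreover have "compact K" "K \<subseteq> verts G"
    using ecc by (auto simp: eccentric_p_summing_wrt_def)
  moreover have "E_p p G f v1 v2 \<le> eccentric_const p (verts G) K f * d_p_measure p \<mu> G v1 v2"
    if "v1 \<in> verts G" "v2 \<in> verts G" for v1 v2
    unfolding d_p_measure_def
    by (rule E_p_le_mult[OF p assms(3) that eccentric_bound_eccentric_const(2)[OF \<open>1 \<le> p\<close> ecc] dom])
      simp_all
  ultimately show "\<exists>S \<mu>. compact S \<and> S \<subseteq> verts G \<and> regular_borel_prob_on S \<mu> \<and>
      (\<forall>v1\<in>verts G. \<forall>v2\<in>verts G.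
         E_p p G f v1 v2 \<le> eccentric_const p (verts G) K f * d_p_measure p \<mu> G v1 v2)"
    by blast
qed

end
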